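(* Let $G$ be a finite simple bipartite graph with at least one edge and let $k=es_{\chi'}(G)$. Then there exists a mitigating set of $G$ which is a $k$-matching.
   Context: All graphs are finite, simple and have at least one edge. $\chi'(G)$ is the chromatic index of $G$. A mitigating set of $G$ is a set of edges $F\subseteq E(G)$ such that $\chi'(G\setminus F)<\chi'(G)$, where $G\setminus F$ is $G$ with the edges of $F$ deleted (all vertices are kept; an edgeless graph has chromatic index $0$). The chromatic edge stability index $es_{\chi'}(G)$ is the minimum cardinality of a mitigating set of $G$. A matching is a set of pairwise non-adjacent edges; a $k$-matching is a matching of size $k$. *)

theory Defs
  imports Main
begin

text \<open>An edge is the two-element set of its end vertices, so loops, multiple edges and
  orientations cannot occur.\<close>

record 'a sgraph =
  verts :: "'a set"
  edges :: "'a set set"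

definition finite_simple_graph :: "'a sgraph \<Rightarrow> bool" where
  "finite_simple_graph G \<longleftrightarrow>
     finite (verts G) \<and> edges G \<subseteq> {{u, v} | u v. u \<in> verts G \<and> v \<in> verts G \<and> u \<noteq> v}"

definition bipartite :: "'a sgraph \<Rightarrow> bool" where
  "bipartite G \<longleftrightarrow>
     (\<exists>X Y. X \<union> Y = verts G \<and> X \<inter> Y = {} \<and> (\<forall>e \<in> edges G. \<exists>x \<in> X. \<exists>y \<in> Y. e = {x, y}))"

definition adjacent_edges :: "'a set \<Rightarrow> 'a set \<Rightarrow> bool" where
  "adjacent_edges e f \<longleftrightarrow> e \<noteq> f \<and> e \<inter> f \<noteq> {}"

definition delete_edges :: "'a sgraph \<Rightarrow> 'a set set \<Rightarrow> 'a sgraph" where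
  "delete_edges G F = G\<lparr>edges := edges G - F\<rparr>"

definition proper_edge_colouring :: "'a sgraph \<Rightarrow> nat \<Rightarrow> ('a set \<Rightarrow> nat) \<Rightarrow> bool" where
  "proper_edge_colouring G k c \<longleftrightarrow>
     (\<forall>e \<in> edges G. c e < k) \<and>
     (\<forall>e \<in> edges G. \<forall>f \<in> edges G. adjacent_edges e f \<longrightarrow> c e \<noteq> c f)"

definition chromatic_index :: "'a sgraph \<Rightarrow> nat" where
  "chromatic_index G = (LEAST k. \<exists>c. proper_edge_colouring G k c)"

definition mitigating_set :: "'a sgraph \<Rightarrow> 'a set set \<Rightarrow> bool" where
  "mitigating_set G F \<longleftrightarrow>
     F \<subseteq> edges G \<and> chromatic_index (delete_edges G F) < chromatic_index G"

definition chromatic_edge_stability_index :: "'a sgraph \<Rightarrow> nat" where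
  "chromatic_edge_stability_index G = (LEAST k. \<exists>F. mitigating_set G F \<and> card F = k)"

definition matching :: "'a sgraph \<Rightarrow> 'a set set \<Rightarrow> bool" where
  "matching G M \<longleftrightarrow>
     M \<subseteq> edges G \<and> (\<forall>e \<in> M. \<forall>f \<in> M. \<not> adjacent_edges e f)"

definition k_matching :: "'a sgraph \<Rightarrow> nat \<Rightarrow> 'a set set \<Rightarrow> bool" where
  "k_matching G k M \<longleftrightarrow> matching G M \<and> card M = k"

text \<open>Both \<open>LEAST\<close> operators range over nonempty sets in the intended situations.\<close>

lemma finite_simple_graph_finite_edges:
  assumes "finite_simple_graph G"
  shows "finite (edges G)"
proof (rule finite_subset)
  show "edges G \<subseteq> Pow (verts G)"
    using assms by (auto simp: finite_simple_graph_def)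
  show "finite (Pow (verts G))"
    using assms by (simp add: finite_simple_graph_def)
qed

lemma chromatic_index_attained:
  assumes "finite_simple_graph G"
  shows "\<exists>c. proper_edge_colouring G (chromatic_index G) c"
proof -
  obtain c :: "'a set \<Rightarrow> nat" and n where c: "c ` edges G = {i. i < n}" "inj_on c (edges G)"
    using finite_imp_inj_to_nat_seg[OF finite_simple_graph_finite_edges[OF assms]] by blast
  have "proper_edge_colouring G n c"
    using c by (auto simp: proper_edge_colouring_def adjacent_edges_def inj_on_def)
  then have "\<exists>k c. proper_edge_colouring G k c" by blast
  then show ?thesis
    unfolding chromatic_index_def by (rule LeastI_ex)
qed

lemma chromatic_index_edgeless:
  "edges G = {} \<Longrightarrow> chromatic_index G = 0"
  unfolding chromatic_index_def
  by (rule Least_eq_0) (auto simp: proper_edge_colouring_def)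

lemma mitigating_set_all_edges:
  assumes "finite_simple_graph G" "edges G \<noteq> {}"
  shows "mitigating_set G (edges G)"
proof -
  have "chromatic_index (delete_edges G (edges G)) = 0"
    by (rule chromatic_index_edgeless) (simp add: delete_edges_def)
  moreover have "chromatic_index G \<noteq> 0"
    using chromatic_index_attained[OF assms(1)] assms(2)
    by (auto simp: proper_edge_colouring_def)
  ultimately show ?thesis
    by (simp add: mitigating_set_def)
qed

end

theory Submission
  imports Defs "HOL-Combinatorics.Transposition" "HOL-Library.Disjoint_Sets"
begin

text \<open>
  By Koenig's edge colouring theorem, a bipartite graph is \<open>d\<close>-edge-colourable as soon as all
  its degrees are at most \<open>d\<close>.  Hence, with \<open>q\<close> the chromatic index of \<open>G\<close> and \<open>D\<close> the set of
  vertices of degree \<open>q\<close>, a set of edges is mitigating iff it covers \<open>D\<close>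
  (\<open>mitigating_set_iff_covers\<close>), and the question becomes whether some smallest set of edges
  covering \<open>D\<close> is a matching.

  One matching \<open>M\<close> covering \<open>D\<close>, possibly too large, is at hand: a colour class of a
  \<open>q\<close>-edge-colouring, since all \<open>q\<close> colours occur at a vertex of degree \<open>q\<close>.  Among the smallest
  sets of edges covering \<open>D\<close>, take one, \<open>F\<close>, that shares as many edges as possible with \<open>M\<close>.
  If two edges of \<open>F\<close> met in a vertex \<open>c\<close>, one of them, \<open>{a, c}\<close>, would lie outside the matching
  \<open>M\<close>.  As \<open>F\<close> is smallest and \<open>c\<close> is covered twice, \<open>a\<close> is in \<open>D\<close> and is covered by no other edge of \<open>F\<close>.
  Replacing \<open>{a, c}\<close> by the edge of \<open>M\<close> at \<open>a\<close> gives a set of the same size that still covers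
  \<open>D\<close> and has more edges in \<open>M\<close>, a contradiction.  So \<open>F\<close> is a matching
  (\<open>minimum_cover_exchange\<close>).
\<close>

definition edges_at :: "'a set set \<Rightarrow> 'a \<Rightarrow> 'a set set" where
  "edges_at E v = {e \<in> E. v \<in> e}"

text \<open>Properness is expressed as injectivity at each vertex, so that bounds on degrees are
  statements about injective maps into \<open>{..<d}\<close>.\<close>

definition edge_colouring :: "'a set set \<Rightarrow> nat \<Rightarrow> ('a set \<Rightarrow> nat) \<Rightarrow> bool" where
  "edge_colouring E d c \<longleftrightarrow> c ` E \<subseteq> {..<d} \<and> (\<forall>v. inj_on c (edges_at E v))"

definition bipartition :: "'a set set \<Rightarrow> 'a set \<Rightarrow> 'a set \<Rightarrow> bool" where
  "bipartition E X Y \<longleftrightarrow> X \<inter> Y = {} \<and> (\<forall>e\<in>E. \<exists>x\<in>X. \<exists>y\<in>Y. e = {x, y})"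

lemma proper_edge_colouring_iff: "proper_edge_colouring G d c \<longleftrightarrow> edge_colouring (edges G) d c"
proof -
  have "(\<forall>e\<in>edges G. \<forall>f\<in>edges G. adjacent_edges e f \<longrightarrow> c e \<noteq> c f) \<longleftrightarrow>
      (\<forall>v. inj_on c (edges_at (edges G) v))"
    unfolding edges_at_def adjacent_edges_def inj_on_def by blast
  then show ?thesis
    by (auto simp: proper_edge_colouring_def edge_colouring_def)
qed

lemma edge_colouring_degree_le:
  assumes "edge_colouring E d c"
  shows "card (edges_at E v) \<le> d"
  using assms card_inj_on_le[of c "edges_at E v" "{..<d}"]
  by (auto simp: edge_colouring_def edges_at_def)

section \<open>Edge colourings of bipartite graphs\<close>

text \<open>A colour free at \<open>v\<close> can be freed at \<open>u\<close> as well: interchange the colours \<open>a\<close> and \<open>b\<close> on the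
  Kempe chain \<open>S\<close> through \<open>u\<close>.  Starting at \<open>u \<in> X\<close>, the chain leaves vertices of \<open>X\<close> by edges
  coloured \<open>b\<close> only, so it enters \<open>Y\<close> by such edges and never reaches \<open>v\<close>, where \<open>b\<close> is free.
  No edge coloured \<open>a\<close> or \<open>b\<close> leads out of \<open>S\<close>; hence at each vertex the colours are either
  all permuted or all kept, and the colouring stays proper.\<close>

lemma kempe_swap:
  assumes bip: "bipartition E X Y" and col: "edge_colouring E d c"
    and u: "u \<in> X" and v: "v \<in> Y" and d: "a < d" "b < d"
    and a: "a \<notin> c ` edges_at E u" and b: "b \<notin> c ` edges_at E v"
  shows "\<exists>c'. edge_colouring E d c' \<and> b \<notin> c' ` edges_at E u \<and> b \<notin> c' ` edges_at E v"
proof -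
  define out where "out p = (if p \<in> X then b else a)" for p
  define R where "R = {(p, q). {p, q} \<in> E \<and> c {p, q} = out p}"
  define S where "S = R\<^sup>* `` {u}"
  have opposite: "out q = (if p \<in> X then a else b)" "q \<in> Y \<longleftrightarrow> p \<in> X"
    if pq: "{p, q} \<in> E" for p q
  proof -
    obtain x y where "x \<in> X" "y \<in> Y" "{p, q} = {x, y}"
      using bip pq unfolding bipartition_def by blast
    moreover have "X \<inter> Y = {}"
      using bip by (simp add: bipartition_def)
    ultimately have "p \<in> X \<and> q \<notin> X \<and> q \<in> Y \<or> p \<notin> X \<and> q \<in> X \<and> q \<notin> Y"
      unfolding doubleton_eq_iff by blast
    then show "out q = (if p \<in> X then a else b)" "q \<in> Y \<longleftrightarrow> p \<in> X"
      by (auto simp: out_def)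
  qed
  have inj: "inj_on c (edges_at E w)" for w
    using col by (simp add: edge_colouring_def)
  have uS: "u \<in> S"
    by (simp add: S_def)
  have pred: "\<exists>p'\<in>S. (p', p) \<in> R" if "p \<in> S" "p \<noteq> u" for p
    using that unfolding S_def by (metis Image_singleton_iff rtranclE)
  have vS: "v \<notin> S"
  proof
    assume "v \<in> S"
    moreover have "v \<noteq> u"
      using u v bip by (auto simp: bipartition_def)
    ultimately obtain p where "(p, v) \<in> R"
      using pred by blast
    then have "{p, v} \<in> edges_at E v" "c {p, v} = b"
      using opposite(2)[of p v] v by (simp_all add: R_def edges_at_def out_def)
    then have "b \<in> c ` edges_at E v"
      by (metis image_eqI)
    with b show False ..
  qed
  have closed: "e \<subseteq> S" if e: "e \<in> E" "c e \<in> {a, b}" and w: "w \<in> e" "w \<in> S" for e w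
  proof -
    obtain x y where "e = {x, y}"
      using bip e(1) unfolding bipartition_def by blast
    then obtain q where q: "e = {w, q}"
      using w(1) by (auto simp: insert_commute)
    have "q \<in> S"
    proof (cases "c e = out w")
      case True
      then have "(w, q) \<in> R"
        using e q by (simp add: R_def)
      then show ?thesis
        using w(2) by (auto simp: S_def intro: rtrancl_into_rtrancl)
    next
      \<comment> \<open>The edge by which the chain entered \<open>w\<close> has the same colour as \<open>e\<close>, hence is \<open>e\<close>.\<close>
      case False
      have "w \<noteq> u"
        using False a e q u by (auto simp: out_def edges_at_def)
      then obtain p where p: "p \<in> S" "(p, w) \<in> R"
        using pred w by blast
      then have pw: "{p, w} \<in> E" "c {p, w} = out p"
        by (simp_all add: R_def)
      then have "c {p, w} = c e"
        using False e opposite(1)[OF pw(1)] by (auto simp: out_def split: if_splits)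
      then have "{p, w} = e"
        using pw(1) e(1) w(1) by (intro inj_onD[OF inj[of w]]) (simp_all add: edges_at_def)
      then have "q = p"
        using q by (metis doubleton_eq_iff)
      then show ?thesis
        using p(1) by simp
    qed
    with q w show ?thesis by simp
  qed
  define c' where "c' e = (if e \<inter> S = {} then c e else transpose a b (c e))" for e
  have inside: "c' e = transpose a b (c e)" if "e \<in> edges_at E w" "w \<in> S" for e w
    using that by (auto simp: c'_def edges_at_def)
  have outside: "c' e = c e" if "e \<in> edges_at E w" "w \<notin> S" for e w
    using that closed[of e] by (fastforce simp: c'_def edges_at_def transpose_def)
  have "inj_on c' (edges_at E w)" for w
  proof (cases "w \<in> S")
    case True
    have "inj_on (transpose a b \<circ> c) (edges_at E w)"
      using inj by (rule comp_inj_on) simp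
    then show ?thesis
      using inside[OF _ True] by (simp add: inj_on_def)
  next
    case False
    then show ?thesis
      using inj[of w] outside[OF _ False] by (simp add: inj_on_def)
  qed
  moreover have "c' ` E \<subseteq> {..<d}"
    using col d by (auto simp: edge_colouring_def c'_def transpose_def)
  moreover have "b \<notin> c' ` edges_at E u"
    using a inside[OF _ uS] by (auto simp: transpose_def split: if_splits)
  moreover have "b \<notin> c' ` edges_at E v"
    using b outside[OF _ vS] by auto
  ultimately show ?thesis
    by (auto simp: edge_colouring_def)
qed

text \<open>Koenig's theorem.  Edges are coloured one after another; before an edge \<open>{u, v}\<close> is
  added, both ends have degree less than \<open>d\<close>, hence a free colour each, and a Kempe swap makes
  one colour free at both.\<close>

lemma koenig_edge_colouring:
  assumes "finite E" and "bipartition E X Y" and "\<And>v. card (edges_at E v) \<le> d"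
  shows "\<exists>c. edge_colouring E d c"
  using assms
proof (induction E)
  case empty
  then show ?case
    by (simp add: edge_colouring_def edges_at_def)
next
  case (insert e E)
  have bip: "bipartition E X Y"
    using insert.prems by (simp add: bipartition_def)
  have at_insert: "edges_at (insert e E) w =
      (if w \<in> e then insert e (edges_at E w) else edges_at E w)" for w
    by (auto simp: edges_at_def)
  have fin: "finite (edges_at E w)" and new: "e \<notin> edges_at E w" for w
    using insert.hyps by (auto simp: edges_at_def)
  have small: "card (edges_at E w) < d" if "w \<in> e" for w
    using insert.prems(2)[of w] that fin[of w] new[of w] by (simp add: at_insert)
  have "card (edges_at E w) \<le> d" for w
    using insert.prems(2)[of w] small[of w] by (cases "w \<in> e") (auto simp: at_insert)
  then obtain c where c: "edge_colouring E d c"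
    using insert.IH bip by blast
  have free: "\<exists>i<d. i \<notin> c ` edges_at E w" if "w \<in> e" for w
  proof (rule ccontr)
    assume "\<not> ?thesis"
    then have "{..<d} \<subseteq> c ` edges_at E w" by auto
    then show False
      using surj_card_le[OF fin, of "{..<d}"] small[OF that] by fastforce
  qed
  obtain u v where uv: "u \<in> X" "v \<in> Y" "e = {u, v}"
    using insert.prems(1) by (auto simp: bipartition_def)
  obtain a where a: "a < d" "a \<notin> c ` edges_at E u"
    using free[of u] uv(3) by auto
  obtain b where b: "b < d" "b \<notin> c ` edges_at E v"
    using free[of v] uv(3) by auto
  obtain c' where c': "edge_colouring E d c'"
      "b \<notin> c' ` edges_at E u" "b \<notin> c' ` edges_at E v"
    using kempe_swap[OF bip c uv(1,2) a(1) b(1) a(2) b(2)] by blast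
  have old: "(c'(e := b)) f = c' f" if "f \<in> E" for f
    using that insert.hyps by auto
  have "inj_on (c'(e := b)) (edges_at (insert e E) w)" for w
  proof -
    have "inj_on c' (edges_at E w)"
      using c'(1) by (simp add: edge_colouring_def)
    then have "inj_on (c'(e := b)) (edges_at E w)"
      using new[of w] by (metis fun_upd_other inj_on_cong)
    moreover have "b \<notin> (c'(e := b)) ` edges_at E w" if "w \<in> e"
      using c'(2,3) that uv(3) old by (auto simp: edges_at_def)
    ultimately show ?thesis
      using new[of w] by (simp add: at_insert)
  qed
  moreover have "(c'(e := b)) ` insert e E \<subseteq> {..<d}"
    using c'(1) b(1) old by (auto simp: edge_colouring_def)
  ultimately have "edge_colouring (insert e E) d (c'(e := b))"
    by (simp add: edge_colouring_def)
  then show ?case by blast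
qed

section \<open>Mitigating sets as covers\<close>

lemma chromatic_index_le:
  "edge_colouring (edges G) d c \<Longrightarrow> chromatic_index G \<le> d"
  unfolding chromatic_index_def by (rule Least_le) (auto simp: proper_edge_colouring_iff)

text \<open>The chromatic index drops below \<open>q\<close> iff all degrees do: a vertex of degree \<open>q\<close> needs \<open>q\<close>
  colours, and conversely Koenig's theorem colours a graph with degrees at most \<open>q - 1\<close>.  Since no
  degree of \<open>G\<close> exceeds \<open>q\<close>, it is enough to delete an edge at every vertex of degree \<open>q\<close>.\<close>

lemma mitigating_set_iff_covers:
  assumes G: "finite_simple_graph G" "bipartite G" "edges G \<noteq> {}"
  defines "q \<equiv> chromatic_index G"
  shows "mitigating_set G F \<longleftrightarrow>
    F \<subseteq> edges G \<and> {v. card (edges_at (edges G) v) = q} \<subseteq> \<Union>F"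
proof (cases "F \<subseteq> edges G")
  case False
  then show ?thesis by (simp add: mitigating_set_def)
next
  case True
  define E where "E = edges G"
  define H where "H = delete_edges G F"
  have H: "edges H = E - F"
    by (simp add: H_def E_def delete_edges_def)
  have fin: "finite E"
    using finite_simple_graph_finite_edges[OF G(1)] by (simp add: E_def)
  have fin_at: "finite (edges_at E v)" for v
    using fin by (simp add: edges_at_def)
  obtain c where c: "edge_colouring E q c"
    using chromatic_index_attained[OF G(1)] by (auto simp: proper_edge_colouring_iff E_def q_def)
  have q: "q > 0"
    using c G(3) by (auto simp: edge_colouring_def E_def)
  have "chromatic_index H < q \<longleftrightarrow> (\<forall>v. card (edges_at (E - F) v) < q)"
  proof
    assume less: "chromatic_index H < q"
    have "finite_simple_graph H"
      using G(1) by (auto simp: finite_simple_graph_def H_def delete_edges_def)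
    then obtain c' where "edge_colouring (E - F) (chromatic_index H) c'"
      using chromatic_index_attained by (metis proper_edge_colouring_iff H)
    then show "\<forall>v. card (edges_at (E - F) v) < q"
      using edge_colouring_degree_le less by (metis le_less_trans)
  next
    assume small: "\<forall>v. card (edges_at (E - F) v) < q"
    have "card (edges_at (E - F) v) \<le> q - 1" for v
      using small[rule_format, of v] by linarith
    moreover obtain X Y where "bipartition E X Y"
      using G(2) unfolding bipartite_def bipartition_def E_def by blast
    then have "bipartition (E - F) X Y"
      by (simp add: bipartition_def)
    ultimately obtain c' where "edge_colouring (edges H) (q - 1) c'"
      using koenig_edge_colouring[of "E - F" X Y "q - 1"] fin H by auto
    then show "chromatic_index H < q"
      using chromatic_index_le q by fastforce
  qed
  also have "\<dots> \<longleftrightarrow> (\<forall>v. card (edges_at E v) = q \<longrightarrow> v \<in> \<Union>F)"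
  proof (rule iff_allI)
    fix v
    have le: "card (edges_at E v) \<le> q"
      using edge_colouring_degree_le[OF c] .
    have sub: "edges_at (E - F) v \<subseteq> edges_at E v"
      by (auto simp: edges_at_def)
    show "card (edges_at (E - F) v) < q \<longleftrightarrow> (card (edges_at E v) = q \<longrightarrow> v \<in> \<Union>F)"
    proof (cases "v \<in> \<Union>F")
      case True
      then have "edges_at (E - F) v \<subset> edges_at E v"
        using \<open>F \<subseteq> edges G\<close> by (auto simp: edges_at_def E_def)
      then show ?thesis
        using True le psubset_card_mono[OF fin_at] by (meson less_le_trans)
    next
      case False
      then have "edges_at (E - F) v = edges_at E v"
        by (auto simp: edges_at_def)
      then show ?thesis
        using False le by auto
    qed
  qed
  finally show ?thesis
    using True by (auto simp: mitigating_set_def H_def E_def q_def)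
qed

section \<open>Turning a smallest cover into a matching\<close>

text \<open>The size of \<open>F \<inter> M\<close> serves as potential: two meeting edges of a smallest cover \<open>F\<close> allow
  an exchange with an edge of \<open>M\<close> that increases it.\<close>

lemma minimum_cover_exchange:
  assumes E: "finite E" "\<And>e. e \<in> E \<Longrightarrow> card e = 2"
    and M: "M \<subseteq> E" "disjoint M" "D \<subseteq> \<Union>M"
    and F0: "F0 \<subseteq> E" "D \<subseteq> \<Union>F0"
    and min: "\<And>F. F \<subseteq> E \<Longrightarrow> D \<subseteq> \<Union>F \<Longrightarrow> card F0 \<le> card F"
  shows "\<exists>F\<subseteq>E. D \<subseteq> \<Union>F \<and> card F = card F0 \<and> disjoint F"
proof -
  define P where "P F \<longleftrightarrow> F \<subseteq> E \<and> D \<subseteq> \<Union>F \<and> card F = card F0" for F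
  have finP: "finite F" if "P F" for F
    using that E(1) finite_subset by (auto simp: P_def)
  have "card (F \<inter> M) \<le> card E" if "P F" for F
    using that E(1) by (intro card_mono) (auto simp: P_def)
  then obtain F where F: "P F" and max: "\<And>F'. P F' \<Longrightarrow> card (F' \<inter> M) \<le> card (F \<inter> M)"
    using ex_has_greatest_nat[of P F0 "\<lambda>F. card (F \<inter> M)" "Suc (card E)"] F0
    by (auto simp: P_def less_Suc_eq_le)
  have no_meet: "f \<inter> g = {}" if fg: "f \<in> F" "g \<in> F" "f \<noteq> g" and fM: "f \<notin> M" for f g
  proof (rule ccontr)
    assume "f \<inter> g \<noteq> {}"
    then obtain x where x: "x \<in> f" "x \<in> g" by blast
    have "card (F - {f}) < card F0"
      using F finP[OF F] fg(1) by (metis P_def card_Diff1_less)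
    then have "\<not> D \<subseteq> \<Union>(F - {f})"
      using min[of "F - {f}"] F by (force simp: P_def)
    then obtain y where y: "y \<in> D" "y \<notin> \<Union>(F - {f})"
      by blast
    have only_f: "h = f" if "h \<in> F" "y \<in> h" for h
      using y(2) that by blast
    have "y \<in> f"
      using only_f F y(1) by (auto simp: P_def)
    have "x \<noteq> y"
      using x only_f[of g] fg by blast
    have "card f = 2"
      using E(2) F fg(1) by (auto simp: P_def)
    then have f: "f = {x, y}"
      using x(1) \<open>y \<in> f\<close> \<open>x \<noteq> y\<close> by (auto simp: card_2_iff)
    obtain m where m: "m \<in> M" "y \<in> m"
      using M(3) y(1) by blast
    have mF: "m \<notin> F"
      using only_f m fM by blast
    \<comment> \<open>The other end \<open>x\<close> of \<open>f\<close> remains covered by \<open>g\<close>.\<close>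
    define F' where "F' = insert m (F - {f})"
    have "card F' = card F0"
      using F finP[OF F] fg(1) mF card_Suc_Diff1[of F f]
      by (simp add: F'_def P_def)
    moreover have "D \<subseteq> \<Union>F'"
    proof
      fix z
      assume "z \<in> D"
      then obtain h where "h \<in> F" "z \<in> h"
        using F by (auto simp: P_def)
      then show "z \<in> \<Union>F'"
        using f fg x(2) m(2) by (cases "h = f") (auto simp: F'_def)
    qed
    ultimately have "P F'"
      using F M(1) m(1) by (auto simp: P_def F'_def)
    moreover have "F' \<inter> M = insert m (F \<inter> M)"
      using m(1) fM by (auto simp: F'_def)
    then have "card (F' \<inter> M) = Suc (card (F \<inter> M))"
      using finP[OF F] mF by simp
    ultimately show False
      using max[of F'] by simp
  qed
  have "disjoint F"
    unfolding disjoint_def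
    using no_meet M(2) by (metis Int_commute disjoint_def)
  with F show ?thesis
    by (auto simp: P_def)
qed

theorem theorem6p1:
  fixes G :: "'a sgraph" and k :: nat
  assumes "finite_simple_graph G"
    and "bipartite G"
    and "edges G \<noteq> {}"
    and "k = chromatic_edge_stability_index G"
  shows "\<exists>F. mitigating_set G F \<and> k_matching G k F"
proof -
  define E where "E = edges G"
  define q where "q = chromatic_index G"
  define D where "D = {v. card (edges_at E v) = q}"
  have mitigating: "mitigating_set G F \<longleftrightarrow> F \<subseteq> E \<and> D \<subseteq> \<Union>F" for F
    using mitigating_set_iff_covers[OF assms(1-3)] by (simp add: D_def E_def q_def)
  have E: "finite E" "\<And>e. e \<in> E \<Longrightarrow> card e = 2"
    using finite_simple_graph_finite_edges[OF assms(1)] assms(1)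
    by (auto simp: E_def finite_simple_graph_def)
  obtain c where c: "edge_colouring E q c"
    using chromatic_index_attained[OF assms(1)]
    by (auto simp: proper_edge_colouring_iff E_def q_def)
  have q: "q > 0"
    using c assms(3) by (auto simp: edge_colouring_def E_def)
  define M where "M = {e \<in> E. c e = 0}"
  have "disjoint M"
    unfolding disjoint_def
  proof (intro ballI impI)
    fix e f
    assume ef: "e \<in> M" "f \<in> M" "e \<noteq> f"
    have "e = f" if "v \<in> e" "v \<in> f" for v
      using c that ef(1,2) inj_onD[of c "edges_at E v" e f]
      by (auto simp: M_def edge_colouring_def edges_at_def)
    with ef(3) show "e \<inter> f = {}" by blast
  qed
  moreover have "D \<subseteq> \<Union>M"
  proof
    fix v
    assume "v \<in> D"
    \<comment> \<open>The \<open>q\<close> edges at \<open>v\<close> have distinct colours among \<open>q\<close> colours, so colour \<open>0\<close> occurs.\<close>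
    then have "c ` edges_at E v = {..<q}"
      using c by (intro card_subset_eq) (auto simp: D_def edge_colouring_def card_image edges_at_def)
    with q have "0 \<in> c ` edges_at E v" by simp
    then show "v \<in> \<Union>M"
      by (auto simp: M_def edges_at_def)
  qed
  moreover obtain F0 where F0: "mitigating_set G F0" "card F0 = k"
    unfolding assms(4) chromatic_edge_stability_index_def
    using LeastI_ex[of "\<lambda>k. \<exists>F. mitigating_set G F \<and> card F = k"]
      mitigating_set_all_edges[OF assms(1,3)] by blast
  moreover have "card F0 \<le> card F" if "F \<subseteq> E" "D \<subseteq> \<Union>F" for F
    unfolding F0(2) assms(4) chromatic_edge_stability_index_def
    using that mitigating by (intro Least_le) blast
  ultimately obtain F where "F \<subseteq> E" "D \<subseteq> \<Union>F" "card F = k" "disjoint F"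
    using minimum_cover_exchange[OF E, of M D F0] mitigating by (auto simp: M_def)
  then have "mitigating_set G F" "k_matching G k F"
    using mitigating unfolding k_matching_def matching_def adjacent_edges_def disjoint_def E_def
    by blast+
  then show ?thesis by blast
qed

end
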